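(* For every real number $x\ge1$, the power series $[x]_q\in\mathbb Z[[q]]$ converges in the disk $|q|<2-\sqrt3$ and defines a non-vanishing holomorphic function on this disk.
   Context: For an integer $n\ge 0$ put $[n]_q=\frac{1-q^n}{1-q}$. Every real $x\ge1$ has a unique expansion as an infinite negative continued fraction $x=[[c_1,c_2,\ldots]]:=c_1-\frac{1}{c_2-\frac{1}{c_3-\cdots}}$ with integers $c_j\ge2$ (rational $x$ correspond to sequences that are eventually equal to $2$). For $N\ge1$ set $$[x]_{N,q}:=[c_1]_q-\frac{q^{c_1-1}}{[c_2]_q-\cdots\frac{q^{c_{N-1}-1}}{[c_N]_q}}.$$ These rational functions, expanded at $q=0$, converge $q$-adically as $N\to\infty$, and $[x]_q\in\mathbb Z[[q]]$ denotes their limit. *)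

theory Defs
  imports "HOL-Analysis.Analysis"
begin

section \<open>Infinite negative continued fractions\<close>

text \<open>
  Digit sequences are indexed from 0, so \<open>c j\<close> is the digit $c_{j+1}$ of the usual
  notation, and the convergent with index \<open>N\<close> uses the \<open>N + 1\<close> digits \<open>c 0, \<dots>, c N\<close>.
\<close>

primrec ncf_conv :: "nat \<Rightarrow> (nat \<Rightarrow> nat) \<Rightarrow> real" where
  "ncf_conv 0 c = real (c 0)"
| "ncf_conv (Suc N) c = real (c 0) - 1 / ncf_conv N (\<lambda>j. c (Suc j))"

definition is_ncf_expansion :: "(nat \<Rightarrow> nat) \<Rightarrow> real \<Rightarrow> bool" where
  "is_ncf_expansion c x \<longleftrightarrow> (\<forall>j. 2 \<le> c j) \<and> (\<lambda>N. ncf_conv N c) \<longlonglongrightarrow> x"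

text \<open>Well-defined for \<open>x \<ge> 1\<close> only; see \<open>ex1_ncf_expansion\<close> below.\<close>

definition ncf_digits :: "real \<Rightarrow> nat \<Rightarrow> nat" where
  "ncf_digits x = (THE c. is_ncf_expansion c x)"


section \<open>\<open>q\<close>-deformed real numbers\<close>

text \<open>
  The rational functions in \<open>q\<close> that occur below have no pole at \<open>q = 0\<close>, and they are
  represented by their expansions at \<open>q = 0\<close>, i.e. inside the ring of formal power series over
  the rationals with \<open>q = fps_X\<close>. All denominators have constant term 1 when the digits are at
  least 2, so that division of power series is the expansion of the quotient. The topology on
  formal power series is the \<open>q\<close>-adic one.
\<close>

definition q_int :: "nat \<Rightarrow> rat fps" where
  "q_int n = (1 - fps_X ^ n) / (1 - fps_X)"

primrec q_conv :: "nat \<Rightarrow> (nat \<Rightarrow> nat) \<Rightarrow> rat fps" where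
  "q_conv 0 c = q_int (c 0)"
| "q_conv (Suc N) c = q_int (c 0) - fps_X ^ (c 0 - 1) / q_conv N (\<lambda>j. c (Suc j))"

definition of_int_fps :: "int fps \<Rightarrow> 'a :: ring_1 fps" where
  "of_int_fps f = Abs_fps (\<lambda>n. of_int (fps_nth f n))"

text \<open>The unique integral power series which is the limit; see \<open>ex1_q_real\<close> below.\<close>

definition q_real :: "real \<Rightarrow> int fps" where
  "q_real x = (THE f. (\<lambda>N. q_conv N (ncf_digits x)) \<longlonglongrightarrow> of_int_fps f)"


section \<open>Well-definedness\<close>

lemma ncf_conv_gt_1:
  assumes "\<And>j. 2 \<le> c j"
  shows "ncf_conv N c > 1"
  using assms
proof (induction N arbitrary: c)
  case 0
  from 0[of 0] show ?case by simp
next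
  case (Suc N)
  have "ncf_conv N (\<lambda>j. c (Suc j)) > 1" by (rule Suc.IH) (rule Suc.prems)
  hence "1 / ncf_conv N (\<lambda>j. c (Suc j)) < 1" by simp
  moreover have "real (c 0) \<ge> 2" using Suc.prems[of 0] by simp
  ultimately show ?case by simp
qed

lemma ncf_conv_Suc_less:
  assumes "\<And>j. 2 \<le> c j"
  shows "ncf_conv (Suc N) c < ncf_conv N c"
  using assms
proof (induction N arbitrary: c)
  case 0
  have "c 1 > 0" using 0[of 1] by simp
  thus ?case by simp
next
  case (Suc N)
  have "ncf_conv (Suc N) (\<lambda>j. c (Suc j)) < ncf_conv N (\<lambda>j. c (Suc j))"
    by (rule Suc.IH) (rule Suc.prems)
  moreover have "ncf_conv (Suc N) (\<lambda>j. c (Suc j)) > 1"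
    by (rule ncf_conv_gt_1) (rule Suc.prems)
  ultimately have "1 / ncf_conv N (\<lambda>j. c (Suc j)) < 1 / ncf_conv (Suc N) (\<lambda>j. c (Suc j))"
    by (intro divide_strict_left_mono) auto
  thus ?case by (simp only: ncf_conv.simps(2))
qed

lemma ncf_conv_convergent:
  assumes "\<And>j. 2 \<le> c j"
  obtains x where "is_ncf_expansion c x" "x \<ge> 1"
proof -
  have "decseq (\<lambda>N. ncf_conv N c)"
    using ncf_conv_Suc_less[of c] assms by (intro decseq_SucI less_imp_le) auto
  then obtain x where x: "(\<lambda>N. ncf_conv N c) \<longlonglongrightarrow> x"
    using decseq_convergent[of "\<lambda>N. ncf_conv N c" 1] ncf_conv_gt_1[of c] assms
    by (metis less_imp_le)
  moreover have "x \<ge> 1"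
    using ncf_conv_gt_1[of c] assms
    by (intro LIMSEQ_le_const[OF x]) (auto intro: less_imp_le)
  ultimately show ?thesis using that assms by (auto simp: is_ncf_expansion_def)
qed

lemma is_ncf_expansion_step:
  assumes "is_ncf_expansion c x"
  obtains y where "is_ncf_expansion (\<lambda>j. c (Suc j)) y" "y \<ge> 1" "x = c 0 - 1 / y"
proof -
  have c: "2 \<le> c j" for j using assms by (simp add: is_ncf_expansion_def)
  obtain y where y: "is_ncf_expansion (\<lambda>j. c (Suc j)) y" "y \<ge> 1"
    using ncf_conv_convergent[of "\<lambda>j. c (Suc j)"] c by blast
  have "(\<lambda>N. ncf_conv (Suc N) c) \<longlonglongrightarrow> c 0 - 1 / y"
    using y unfolding ncf_conv.simps is_ncf_expansion_def by (auto intro!: tendsto_intros)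
  moreover have "(\<lambda>N. ncf_conv (Suc N) c) \<longlonglongrightarrow> x"
    using assms unfolding is_ncf_expansion_def by (intro LIMSEQ_Suc) auto
  ultimately have "x = c 0 - 1 / y" using LIMSEQ_unique by blast
  thus ?thesis using that y by blast
qed

lemma is_ncf_expansion_unique:
  assumes "is_ncf_expansion c x" "is_ncf_expansion d x"
  shows "c = d"
proof
  have hd: "int (c 0) = \<lfloor>x\<rfloor> + 1" if e: "is_ncf_expansion c x" for c x
  proof -
    obtain y where y: "is_ncf_expansion (\<lambda>j. c (Suc j)) y" "y \<ge> 1" "x = c 0 - 1 / y"
      using is_ncf_expansion_step[OF e] .
    hence "0 < 1 / y" "1 / y \<le> 1" by auto
    hence "of_int (int (c 0) - 1) \<le> x" "x < of_int (int (c 0) - 1) + 1" using y(3) by auto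
    hence "\<lfloor>x\<rfloor> = int (c 0) - 1" by (intro floor_unique) auto
    thus ?thesis by simp
  qed
  fix j
  show "c j = d j" using assms
  proof (induction j arbitrary: c d x)
    case 0
    thus ?case using hd[of c x] hd[of d x] by simp
  next
    case (Suc j)
    obtain y where y: "is_ncf_expansion (\<lambda>j. c (Suc j)) y" "y \<ge> 1" "x = c 0 - 1 / y"
      using is_ncf_expansion_step[OF Suc.prems(1)] .
    obtain z where z: "is_ncf_expansion (\<lambda>j. d (Suc j)) z" "z \<ge> 1" "x = d 0 - 1 / z"
      using is_ncf_expansion_step[OF Suc.prems(2)] .
    have "c 0 = d 0" using hd[of c x] hd[of d x] Suc.prems by simp
    hence "1 / y = 1 / z" using y z by simp
    hence "y = z" by simp
    thus ?case using Suc.IH[OF y(1)] z(1) by simp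
  qed
qed

lemma is_ncf_expansion_exists:
  fixes x :: real
  assumes "x \<ge> 1"
  shows "\<exists>c. is_ncf_expansion c x"
proof -
  define y where "y = rec_nat x (\<lambda>_ t. 1 / (of_int (\<lfloor>t\<rfloor> + 1) - t))"
  define c where "c = (\<lambda>n. nat (\<lfloor>y n\<rfloor> + 1))"
  have y0: "y 0 = x" by (simp add: y_def)
  have ySuc: "y (Suc n) = 1 / (of_int (\<lfloor>y n\<rfloor> + 1) - y n)" for n by (simp add: y_def)
  have y_ge: "y n \<ge> 1" for n
  proof (cases n)
    case 0
    thus ?thesis using assms y0 by simp
  next
    case (Suc m)
    have "of_int (\<lfloor>y m\<rfloor> + 1) - y m > 0" "of_int (\<lfloor>y m\<rfloor> + 1) - y m \<le> 1"
      by linarith+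
    thus ?thesis by (simp add: Suc ySuc)
  qed
  have c: "real (c n) = of_int (\<lfloor>y n\<rfloor> + 1)" for n
    using y_ge[of n] by (simp add: c_def)
  have c2: "2 \<le> c n" for n
    using y_ge[of n] by (auto simp: c_def le_nat_iff)
  have cy: "y n < real (c n)" "real (c n) \<le> y n + 1" for n
    unfolding c by linarith+
  have y_eq: "y n = real (c n) - 1 / y (Suc n)" for n
    unfolding ySuc c by simp
  have ge: "ncf_conv N (\<lambda>j. c (j + k)) \<ge> y k" for N k
  proof (induction N arbitrary: k)
    case 0
    show ?case using cy(1)[of k] by simp
  next
    case (Suc N)
    have "1 / ncf_conv N (\<lambda>j. c (j + Suc k)) \<le> 1 / y (Suc k)"
      using Suc.IH[of "Suc k"] y_ge[of "Suc k"] by (intro divide_left_mono mult_pos_pos) auto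
    thus ?case using y_eq[of k] by simp
  qed
  have "\<exists>L. is_ncf_expansion (\<lambda>j. c (j + k)) L" for k
    using ncf_conv_convergent[of "\<lambda>j. c (j + k)"] c2 by blast
  then obtain L where L: "\<And>k. is_ncf_expansion (\<lambda>j. c (j + k)) (L k)" by metis
  have L_ge: "L k \<ge> y k" for k
    using L[of k] ge[where k = k] unfolding is_ncf_expansion_def
    by (intro LIMSEQ_le_const[of "\<lambda>N. ncf_conv N (\<lambda>j. c (j + k))"]) auto
  have L_eq: "L k = real (c k) - 1 / L (Suc k)" for k
  proof -
    obtain z where z: "is_ncf_expansion (\<lambda>j. c (Suc j + k)) z" "L k = c (0 + k) - 1 / z"
      using is_ncf_expansion_step[OF L[of k]] by metis
    have "z = L (Suc k)"
      using z(1) L[of "Suc k"] unfolding is_ncf_expansion_def by (auto intro: LIMSEQ_unique)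
    thus ?thesis using z(2) by simp
  qed
  define d where "d = (\<lambda>k. L k - y k)"
  have d_nonneg: "d k \<ge> 0" for k using L_ge[of k] by (simp add: d_def)
  have d_less: "d k < 1" for k
  proof -
    have "L (Suc k) > 0" using L_ge[of "Suc k"] y_ge[of "Suc k"] by linarith
    hence "L k < real (c k)" using L_eq[of k] by simp
    thus ?thesis using cy(2)[of k] by (simp add: d_def)
  qed
  have d_step: "d (Suc k) \<ge> d k + d k ^ 2" for k
  proof -
    have pos: "y (Suc k) \<ge> 1" "L (Suc k) \<ge> 1 + d (Suc k)"
      using y_ge[of "Suc k"] by (auto simp: d_def)
    hence pos': "L (Suc k) > 0" "y (Suc k) > 0" using d_nonneg[of "Suc k"] by linarith+
    have "d k = 1 / y (Suc k) - 1 / L (Suc k)"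
      using y_eq[of k] L_eq[of k] by (simp add: d_def)
    also have "\<dots> = d (Suc k) / (L (Suc k) * y (Suc k))"
      using pos' by (simp add: d_def field_simps)
    finally have eq: "d (Suc k) = d k * (L (Suc k) * y (Suc k))"
      using pos' by (simp add: field_simps)
    have "1 * 1 \<le> L (Suc k) * y (Suc k)"
      using pos pos' d_nonneg[of "Suc k"] by (intro mult_mono) auto
    hence "d k * 1 \<le> d (Suc k)" unfolding eq using d_nonneg[of k] by (intro mult_left_mono) auto
    hence "(1 + d k) * 1 \<le> L (Suc k) * y (Suc k)"
      using pos pos' d_nonneg[of k] by (intro mult_mono) auto
    hence "d k * (1 + d k) \<le> d (Suc k)"
      unfolding eq using d_nonneg[of k] by (intro mult_left_mono) auto
    thus ?thesis by (simp add: algebra_simps power2_eq_square)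
  qed
  have d_ge0: "d k \<ge> d 0" for k
  proof (induction k)
    case (Suc k)
    have "d (Suc k) \<ge> d k" using d_step[of k] zero_le_power2[of "d k"] by linarith
    thus ?case using Suc by linarith
  qed simp
  have d_lin: "d k \<ge> real k * d 0 ^ 2" for k
  proof (induction k)
    case 0
    show ?case using d_nonneg[of 0] by simp
  next
    case (Suc k)
    have "d 0 ^ 2 \<le> d k ^ 2" using d_ge0[of k] d_nonneg[of 0] by (intro power_mono) auto
    thus ?case using d_step[of k] Suc by (simp add: algebra_simps)
  qed
  have "d 0 = 0"
  proof (rule ccontr)
    assume "d 0 \<noteq> 0"
    hence "d 0 ^ 2 > 0" by simp
    then obtain k :: nat where "1 < real k * d 0 ^ 2"
      using reals_Archimedean3 by blast
    thus False using d_lin[of k] d_less[of k] by linarith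
  qed
  hence "L 0 = x" by (simp add: d_def y0)
  thus ?thesis using L[of 0] by auto
qed

lemma ex1_ncf_expansion: "x \<ge> 1 \<Longrightarrow> \<exists>!c. is_ncf_expansion c x"
  using is_ncf_expansion_exists is_ncf_expansion_unique by blast

lemma is_ncf_expansion_ncf_digits: "x \<ge> 1 \<Longrightarrow> is_ncf_expansion (ncf_digits x) x"
  unfolding ncf_digits_def
  using theI'[of "\<lambda>c. is_ncf_expansion c x"] ex1_ncf_expansion[of x] by blast

lemma q_int_eq_sum: "q_int n = (\<Sum>k<n. fps_X ^ k)"
proof -
  have "1 - fps_X ^ n = (1 - fps_X) * (\<Sum>k<n. fps_X ^ k :: rat fps)"
    by (rule one_diff_power_eq)
  moreover have "(1 - fps_X :: rat fps) \<noteq> 0"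
  proof
    assume "(1 - fps_X :: rat fps) = 0"
    hence "fps_nth (1 - fps_X :: rat fps) 0 = 0" by simp
    thus False by simp
  qed
  ultimately show ?thesis by (simp add: q_int_def)
qed

lemma q_conv_nth_0:
  assumes "\<And>j. 2 \<le> c j"
  shows "fps_nth (q_conv N c) 0 = 1"
  using assms
proof (induction N arbitrary: c)
  case 0
  have "fps_nth (q_int (c 0)) 0 = 1"
    using 0[of 0] by (simp add: q_int_eq_sum fps_sum_nth)
  thus ?case by simp
next
  case (Suc N)
  have "fps_nth (q_conv N (\<lambda>j. c (Suc j))) 0 = 1" by (rule Suc.IH) (rule Suc.prems)
  moreover have "fps_nth (q_int (c 0)) 0 = 1"
    using Suc.prems[of 0] by (simp add: q_int_eq_sum fps_sum_nth)
  ultimately show ?case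
    using Suc.prems[of 0] by (simp add: fps_divide_unit)
qed

lemma q_conv_Suc:
  assumes "\<And>j. 2 \<le> c j"
  shows "q_conv (Suc N) c =
    q_int (c 0) - fps_X ^ (c 0 - 1) * inverse (q_conv N (\<lambda>j. c (Suc j)))"
  using q_conv_nth_0[of "\<lambda>j. c (Suc j)" N] assms by (simp add: fps_divide_unit)

lemma fps_inverse_nth_Ints:
  fixes f :: "'a :: field fps"
  assumes "\<And>n. fps_nth f n \<in> \<int>" "fps_nth f 0 = 1"
  shows "fps_nth (inverse f) n \<in> \<int>"
proof (induction n rule: less_induct)
  case (less n)
  show ?case
  proof (cases n)
    case 0
    thus ?thesis using assms by (simp add: fps_inverse_def)
  next
    case (Suc m)
    have "fps_nth (inverse f) n = - (\<Sum>i = 1..n. fps_nth f i * fps_nth (inverse f) (n - i))"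
      using assms(2) unfolding Suc fps_inverse_def by simp
    also have "\<dots> \<in> \<int>"
      using less assms(1) by (intro Ints_minus Ints_sum Ints_mult) auto
    finally show ?thesis .
  qed
qed

lemma q_conv_nth_Ints:
  assumes "\<And>j. 2 \<le> c j"
  shows "fps_nth (q_conv N c) n \<in> \<int>"
  using assms
proof (induction N arbitrary: c n)
  case 0
  show ?case by (auto simp: q_int_eq_sum fps_sum_nth)
next
  case (Suc N)
  have "fps_nth (inverse (q_conv N (\<lambda>j. c (Suc j)))) m \<in> \<int>" for m
    using Suc.prems by (intro fps_inverse_nth_Ints Suc.IH q_conv_nth_0)
  thus ?case
    unfolding q_conv_Suc[of c N, OF Suc.prems]
    by (auto simp: q_int_eq_sum fps_sum_nth fps_X_power_mult_nth intro!: Ints_diff)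
qed

lemma q_conv_diff_dvd:
  assumes "\<And>j. 2 \<le> c j"
  shows "fps_X ^ Suc N dvd q_conv (Suc N) c - q_conv N c"
  using assms
proof (induction N arbitrary: c)
  case 0
  have "(fps_X :: rat fps) ^ Suc 0 dvd fps_X ^ (c 0 - 1)"
    using 0[of 0] by (intro le_imp_power_dvd) auto
  thus ?case
    unfolding q_conv_Suc[of c 0, OF 0] by (simp add: dvd_mult2)
next
  case (Suc N)
  define A where "A = q_conv (Suc N) (\<lambda>j. c (Suc j))"
  define B where "B = q_conv N (\<lambda>j. c (Suc j))"
  have A0: "fps_nth A 0 = 1" unfolding A_def by (rule q_conv_nth_0) (rule Suc.prems)
  have B0: "fps_nth B 0 = 1" unfolding B_def by (rule q_conv_nth_0) (rule Suc.prems)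
  have A1: "inverse A * A = 1" by (rule inverse_mult_eq_1) (simp add: A0)
  have B1: "inverse B * B = 1" by (rule inverse_mult_eq_1) (simp add: B0)
  have "(A - B) * (inverse A * inverse B) =
      (inverse A * A) * inverse B - (inverse B * B) * inverse A"
    by (simp add: algebra_simps)
  hence *: "inverse B - inverse A = (A - B) * (inverse A * inverse B)"
    by (simp add: A1 B1)
  have "fps_X ^ Suc N dvd A - B"
    unfolding A_def B_def by (rule Suc.IH) (rule Suc.prems)
  moreover have "(fps_X :: rat fps) ^ 1 dvd fps_X ^ (c 0 - 1)"
    using Suc.prems[of 0] by (intro le_imp_power_dvd) auto
  ultimately have "fps_X ^ 1 * fps_X ^ Suc N dvd
      fps_X ^ (c 0 - 1) * ((A - B) * (inverse A * inverse B))"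
    by (intro mult_dvd_mono dvd_mult2)
  also have "fps_X ^ (c 0 - 1) * ((A - B) * (inverse A * inverse B)) =
      q_conv (Suc (Suc N)) c - q_conv (Suc N) c"
    unfolding q_conv_Suc[of c "Suc N", OF Suc.prems] q_conv_Suc[of c N, OF Suc.prems]
    unfolding A_def [symmetric] B_def [symmetric] * [symmetric]
    by (simp add: right_diff_distrib)
  finally show ?case by simp
qed

lemma q_conv_limit_exists:
  assumes c: "\<And>j. 2 \<le> c j"
  shows "\<exists>f. (\<lambda>N. q_conv N c) \<longlonglongrightarrow> of_int_fps f"
proof -
  have stable: "fps_nth (q_conv (n + m) c) n = fps_nth (q_conv n c) n" for n m
  proof (induction m)
    case (Suc m)
    obtain g where g: "q_conv (Suc (n + m)) c - q_conv (n + m) c = fps_X ^ Suc (n + m) * g"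
      using q_conv_diff_dvd[of c "n + m"] c by (auto elim: dvdE)
    have "fps_nth (q_conv (Suc (n + m)) c - q_conv (n + m) c) n = 0"
      unfolding g fps_X_power_mult_nth by simp
    thus ?case using Suc by (simp del: q_conv.simps)
  qed simp
  define f where "f = Abs_fps (\<lambda>n. \<lfloor>fps_nth (q_conv n c) n\<rfloor>)"
  have f: "fps_nth (of_int_fps f :: rat fps) n = fps_nth (q_conv n c) n" for n
    using q_conv_nth_Ints[of c n n] c by (auto simp: of_int_fps_def f_def elim: Ints_cases)
  have "(\<lambda>N. q_conv N c) \<longlonglongrightarrow> of_int_fps f"
  proof (rule tendsto_fpsI)
    fix n
    show "\<forall>\<^sub>F N in sequentially. fps_nth (q_conv N c) n = fps_nth (of_int_fps f) n"
      using eventually_ge_at_top[of n]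
    proof eventually_elim
      case (elim N)
      thus ?case using stable[of n "N - n"] by (simp add: f)
    qed
  qed
  thus ?thesis ..
qed

lemma of_int_fps_inject:
  "(of_int_fps f :: 'a :: ring_char_0 fps) = of_int_fps g \<longleftrightarrow> f = g"
  by (auto simp: of_int_fps_def fps_eq_iff)

lemma ex1_q_real:
  assumes "x \<ge> 1"
  shows "\<exists>!f. (\<lambda>N. q_conv N (ncf_digits x)) \<longlonglongrightarrow> of_int_fps f"
proof -
  have "2 \<le> ncf_digits x j" for j
    using is_ncf_expansion_ncf_digits[OF assms] by (simp add: is_ncf_expansion_def)
  then obtain f where "(\<lambda>N. q_conv N (ncf_digits x)) \<longlonglongrightarrow> of_int_fps f"
    using q_conv_limit_exists by blast
  thus ?thesis
    by (intro ex1I) (auto dest: LIMSEQ_unique simp: of_int_fps_inject)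
qed

lemma q_real_LIMSEQ:
  "x \<ge> 1 \<Longrightarrow> (\<lambda>N. q_conv N (ncf_digits x)) \<longlonglongrightarrow> of_int_fps (q_real x)"
  unfolding q_real_def
  using theI'[of "\<lambda>f. (\<lambda>N. q_conv N (ncf_digits x)) \<longlonglongrightarrow> of_int_fps f"] ex1_q_real[of x]
  by blast

end

theory Submission
  imports Defs
begin

text \<open>
  Everything rests on one invariant ball. The map \<open>z \<mapsto> [c]\<^sub>q - q\<^bsup>c-1\<^esup>/z\<close> that prepends a digit
  \<open>c \<ge> 2\<close> to a continued fraction is a composition of two elementary maps: apply
  \<open>L z = 1 + q - q/z\<close> once and then \<open>T z = 1 + q z\<close> exactly \<open>c - 2\<close> times. Let \<open>r\<close> bound the
  size of \<open>q\<close> and put \<open>\<rho> = r/(1 - r)\<close>. Both maps preserve the ball of radius \<open>\<rho>\<close> about \<open>1\<close>: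
  since \<open>T z - 1 = q z\<close>, the map \<open>T\<close> sends it to itself because \<open>r(1 + \<rho>) = \<rho>\<close>; and since
  \<open>L z - 1 = q(z - 1)/z\<close> with \<open>z\<close> at distance at least \<open>1 - \<rho>\<close> from \<open>0\<close>, the map \<open>L\<close> does so as soon
  as \<open>r \<le> 1 - \<rho>\<close>, that is, \<open>3r \<le> 1 + r\<^sup>2\<close>. The last condition holds up to
  \<open>r = (3 - \<surd>5)/2\<close>, and hence for all \<open>r < 2 - \<surd>3\<close>.

  This argument only uses that size is subadditive and submultiplicative, so it can be run for
  formal power series measured by \<open>\<Sum>\<bar>f\<^sub>n\<bar> r\<^sup>n\<close> instead of for their values, and even for the
  partial sums of that norm, where no question of convergence arises. As the convergents of
  \<open>[x]\<^sub>q\<close> stabilise coefficientwise, \<open>[x]\<^sub>q\<close> inherits the bound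
  \<open>\<Sum>\<^bsub>n\<le>K\<^esub> \<bar>f\<^sub>n\<bar> r\<^sup>n \<le> \<rho>\<close> for \<open>f = [x]\<^sub>q - 1\<close> and every \<open>K\<close>. This gives absolute convergence
  for \<open>\<bar>q\<bar> \<le> r\<close>, and \<open>\<bar>[x]\<^sub>q - 1\<bar> \<le> \<rho> < 1\<close> there, so that the sum does not vanish.
\<close>

section \<open>Partial sums of a weighted norm on power series\<close>

text \<open>
  A partial sum of the weighted \<open>\<ell>\<^sup>1\<close> norm. Unlike the full norm it is finite for every series,
  and it depends on finitely many coefficients only, so it is compatible with \<open>q\<close>-adic limits.
\<close>

definition trunc_norm :: "'a::linordered_idom \<Rightarrow> nat \<Rightarrow> 'a fps \<Rightarrow> 'a" where
  "trunc_norm r K f = (\<Sum>n\<le>K. \<bar>fps_nth f n\<bar> * r ^ n)"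

lemma trunc_norm_nonneg: "0 \<le> r \<Longrightarrow> 0 \<le> trunc_norm r K f"
  by (auto simp: trunc_norm_def intro!: sum_nonneg)

lemma trunc_norm_add_le:
  assumes "0 \<le> r"
  shows "trunc_norm r K (f + g) \<le> trunc_norm r K f + trunc_norm r K g"
  unfolding trunc_norm_def sum.distrib [symmetric] distrib_right [symmetric]
  using assms by (auto intro!: sum_mono mult_right_mono)

lemma trunc_norm_minus [simp]: "trunc_norm r K (- f) = trunc_norm r K f"
  by (simp add: trunc_norm_def)

lemma trunc_norm_0 [simp]: "trunc_norm r K 0 = 0"
  by (simp add: trunc_norm_def)

lemma trunc_norm_1 [simp]: "trunc_norm r K 1 = 1"
proof -
  have "trunc_norm r K 1 = (\<Sum>n\<le>K. if n = 0 then 1 else 0)"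
    unfolding trunc_norm_def by (intro sum.cong) auto
  thus ?thesis by simp
qed

lemma trunc_norm_fps_X_le: "0 \<le> r \<Longrightarrow> trunc_norm r K fps_X \<le> r"
proof -
  assume "0 \<le> r"
  have "trunc_norm r K fps_X = (\<Sum>n\<le>K. if n = 1 then r else 0)"
    unfolding trunc_norm_def by (intro sum.cong) (auto simp: fps_X_def)
  thus ?thesis using \<open>0 \<le> r\<close> by simp
qed

text \<open>
  The products \<open>f\<^sub>i g\<^sub>j\<close> that contribute to the left-hand side are those with \<open>i + j \<le> K\<close>, and
  on the right they range over the whole square \<open>i, j \<le> K\<close>.
\<close>

lemma trunc_norm_mult_le:
  assumes "0 \<le> r"
  shows "trunc_norm r K (f * g) \<le> trunc_norm r K f * trunc_norm r K g"
proof -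
  define a where "a = (\<lambda>n. \<bar>fps_nth f n\<bar> * r ^ n)"
  define b where "b = (\<lambda>n. \<bar>fps_nth g n\<bar> * r ^ n)"
  have nonneg: "0 \<le> a i" "0 \<le> b i" for i using assms by (auto simp: a_def b_def)
  have "\<bar>fps_nth (f * g) n\<bar> * r ^ n \<le> (\<Sum>i\<le>n. a i * b (n - i))" for n
  proof -
    have "\<bar>fps_nth (f * g) n\<bar> * r ^ n \<le> (\<Sum>i\<le>n. \<bar>fps_nth f i * fps_nth g (n - i)\<bar>) * r ^ n"
      using assms by (auto simp: fps_mult_nth atMost_atLeast0 intro!: mult_right_mono)
    also have "\<dots> = (\<Sum>i\<le>n. a i * b (n - i))"
      unfolding sum_distrib_right
    proof (intro sum.cong refl)
      fix i assume "i \<in> {..n}"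
      hence "r ^ n = r ^ i * r ^ (n - i)" by (simp add: power_add [symmetric])
      thus "\<bar>fps_nth f i * fps_nth g (n - i)\<bar> * r ^ n = a i * b (n - i)"
        by (simp add: a_def b_def abs_mult)
    qed
    finally show ?thesis .
  qed
  hence "trunc_norm r K (f * g) \<le> (\<Sum>n\<le>K. \<Sum>i\<le>n. a i * b (n - i))"
    unfolding trunc_norm_def by (intro sum_mono)
  also have "\<dots> = (\<Sum>(i, j)\<in>{(i, j). i + j \<le> K}. a i * b j)"
    by (rule sum.triangle_reindex_eq [symmetric])
  also have "\<dots> \<le> (\<Sum>(i, j)\<in>{..K} \<times> {..K}. a i * b j)"
    using nonneg by (intro sum_mono2) auto
  also have "\<dots> = trunc_norm r K f * trunc_norm r K g"
    by (simp add: sum.cartesian_product [symmetric] sum_product trunc_norm_def a_def b_def)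
  finally show ?thesis .
qed

lemma trunc_norm_fps_X_mult_le:
  assumes "0 \<le> r"
  shows "trunc_norm r K (fps_X * f) \<le> r * trunc_norm r K f"
  using trunc_norm_mult_le[OF assms, of K fps_X f]
    mult_right_mono[OF trunc_norm_fps_X_le[OF assms] trunc_norm_nonneg[OF assms]]
  by (rule order_trans)

section \<open>Invariance of the ball under the elementary maps\<close>

text \<open>The ball is invariant under \<open>T z = 1 + q z\<close>, because \<open>\<rho> = r (1 + \<rho>)\<close>.\<close>

lemma trunc_norm_ball_affine:
  fixes r :: "'a::linordered_field"
  assumes r: "0 \<le> r" "r < 1" and f: "trunc_norm r K (f - 1) \<le> r / (1 - r)"
  shows "trunc_norm r K (1 + fps_X * f - 1) \<le> r / (1 - r)"
proof -
  have "trunc_norm r K (1 + fps_X * f - 1) \<le> r * trunc_norm r K ((f - 1) + 1)"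
    using trunc_norm_fps_X_mult_le[OF r(1), of K f] by simp
  also have "\<dots> \<le> r * (r / (1 - r) + 1)"
    using trunc_norm_add_le[OF r(1), of K "f - 1" 1] f r by (intro mult_left_mono) auto
  also have "\<dots> = r / (1 - r)" using r by (simp add: field_simps)
  finally show ?thesis .
qed

text \<open>
  The ball is invariant under \<open>L z = 1 + q - q/z\<close>. Writing \<open>L z - 1 = q g\<close> with
  \<open>g = (z - 1)/z\<close>, the identity \<open>g = (z - 1) - (z - 1) g\<close> replaces the lower bound for the size
  of \<open>z\<close>: it yields \<open>(1 - \<rho>) \<parallel>g\<parallel> \<le> \<rho>\<close>.
\<close>

lemma trunc_norm_ball_inverse:
  fixes r :: "'a::linordered_field"
  assumes r: "0 \<le> r" "r < 1" "3 * r \<le> 1 + r ^ 2"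
    and f: "trunc_norm r K (f - 1) \<le> r / (1 - r)" "fps_nth f 0 \<noteq> 0"
  shows "trunc_norm r K (1 + fps_X - fps_X * inverse f - 1) \<le> r / (1 - r)"
proof -
  define \<rho> where "\<rho> = r / (1 - r)"
  define g where "g = 1 - inverse f"
  have "r \<le> 1 - \<rho>"
    using r by (simp add: \<rho>_def field_simps power2_eq_square)
  have "inverse f * f = 1" using f(2) by (rule inverse_mult_eq_1)
  hence "g = (f - 1) + - ((f - 1) * g)"
    by (simp add: g_def algebra_simps)
  hence "trunc_norm r K g \<le> trunc_norm r K (f - 1) + trunc_norm r K ((f - 1) * g)"
    using trunc_norm_add_le[OF r(1), of K "f - 1" "- ((f - 1) * g)"] by simp
  also have "trunc_norm r K ((f - 1) * g) \<le> trunc_norm r K (f - 1) * trunc_norm r K g"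
    by (rule trunc_norm_mult_le[OF r(1)])
  also have "\<dots> \<le> \<rho> * trunc_norm r K g"
    using f(1) trunc_norm_nonneg[OF r(1)] by (intro mult_right_mono) (auto simp: \<rho>_def)
  finally have g: "(1 - \<rho>) * trunc_norm r K g \<le> \<rho>"
    using f(1) by (simp add: \<rho>_def algebra_simps)
  have "1 + fps_X - fps_X * inverse f - 1 = fps_X * g"
    by (simp add: g_def algebra_simps)
  hence "trunc_norm r K (1 + fps_X - fps_X * inverse f - 1) \<le> r * trunc_norm r K g"
    using trunc_norm_fps_X_mult_le[OF r(1), of K g] by simp
  also have "\<dots> \<le> (1 - \<rho>) * trunc_norm r K g"
    using \<open>r \<le> 1 - \<rho>\<close> trunc_norm_nonneg[OF r(1)] by (intro mult_right_mono) auto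
  finally show ?thesis using g by (simp add: \<rho>_def)
qed

section \<open>Convergents and their limit\<close>

lemma q_int_Suc: "q_int (Suc n) = 1 + fps_X * q_int n"
  by (simp add: q_int_eq_sum sum.lessThan_Suc_shift sum_distrib_left del: sum.lessThan_Suc)

lemma q_int_in_ball:
  assumes r: "0 \<le> r" "r < 1" and "1 \<le> n"
  shows "trunc_norm r K (q_int n - 1) \<le> r / (1 - r)"
  using \<open>1 \<le> n\<close>
proof (induction n rule: dec_induct)
  case base
  show ?case using r by (simp add: q_int_eq_sum)
next
  case (step n)
  show ?case unfolding q_int_Suc by (rule trunc_norm_ball_affine[OF r step.IH])
qed

text \<open>By induction on the digit: passing from \<open>n\<close> to \<open>n + 1\<close> applies \<open>T\<close> once more, and the step for \<open>2\<close> is \<open>L\<close>.\<close>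

lemma digit_step_in_ball:
  assumes r: "0 \<le> r" "r < 1" "3 * r \<le> 1 + r ^ 2"
    and f: "trunc_norm r K (f - 1) \<le> r / (1 - r)" "fps_nth f 0 \<noteq> 0"
    and "2 \<le> n"
  shows "trunc_norm r K (q_int n - fps_X ^ (n - 1) * inverse f - 1) \<le> r / (1 - r)"
  using \<open>2 \<le> n\<close>
proof (induction n rule: dec_induct)
  case base
  have "q_int 2 = 1 + fps_X" by (simp add: q_int_eq_sum numeral_2_eq_2)
  thus ?case using trunc_norm_ball_inverse[OF r f] by simp
next
  case (step n)
  obtain m where "n = Suc m" using step by (cases n) auto
  hence "q_int (Suc n) - fps_X ^ (Suc n - 1) * inverse f =
      1 + fps_X * (q_int n - fps_X ^ (n - 1) * inverse f)"
    unfolding q_int_Suc[of n] by (simp add: algebra_simps)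
  thus ?case using trunc_norm_ball_affine[OF r(1,2) step.IH] by (simp del: add_diff_cancel_left')
qed

lemma q_conv_in_ball:
  assumes r: "0 \<le> r" "r < 1" "3 * r \<le> 1 + r ^ 2" and c: "\<And>j. 2 \<le> c j"
  shows "trunc_norm r K (q_conv N c - 1) \<le> r / (1 - r)"
  using c
proof (induction N arbitrary: c)
  case 0
  show ?case using q_int_in_ball[OF r(1,2), of "c 0" K] 0[of 0] by simp
next
  case (Suc N)
  have "trunc_norm r K (q_conv N (\<lambda>j. c (Suc j)) - 1) \<le> r / (1 - r)"
    by (rule Suc.IH) (rule Suc.prems)
  moreover have "fps_nth (q_conv N (\<lambda>j. c (Suc j))) 0 \<noteq> 0"
    using q_conv_nth_0[of "\<lambda>j. c (Suc j)" N] Suc.prems by simp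
  ultimately show ?case
    unfolding q_conv_Suc[of c N, OF Suc.prems]
    using Suc.prems by (intro digit_step_in_ball[OF r])
qed

text \<open>
  The ball is closed in the \<open>q\<close>-adic topology: up to order \<open>K\<close> the limit coincides with all
  late convergents.
\<close>

lemma q_real_in_ball:
  fixes r :: rat
  assumes "x \<ge> 1" and r: "0 \<le> r" "r < 1" "3 * r \<le> 1 + r ^ 2"
  shows "trunc_norm r K (of_int_fps (q_real x) - 1) \<le> r / (1 - r)"
proof -
  have "\<forall>\<^sub>F N in sequentially. \<forall>n\<in>{..K}.
      fps_nth (q_conv N (ncf_digits x)) n = fps_nth (of_int_fps (q_real x)) n"
    using q_real_LIMSEQ[OF \<open>x \<ge> 1\<close>]
    by (intro eventually_ball_finite) (auto simp: tendsto_fps_iff)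
  then obtain N where N: "\<And>n. n \<le> K \<Longrightarrow>
      fps_nth (q_conv N (ncf_digits x)) n = fps_nth (of_int_fps (q_real x)) n"
    by (auto simp: eventually_sequentially)
  have "trunc_norm r K (of_int_fps (q_real x) - 1) = trunc_norm r K (q_conv N (ncf_digits x) - 1)"
    unfolding trunc_norm_def by (intro sum.cong) (auto simp: N)
  also have "\<dots> \<le> r / (1 - r)"
    using is_ncf_expansion_ncf_digits[OF \<open>x \<ge> 1\<close>]
    by (intro q_conv_in_ball[OF r]) (auto simp: is_ncf_expansion_def)
  finally show ?thesis .
qed

section \<open>Convergence and non-vanishing\<close>

text \<open>The series \<open>f - 1\<close> has a sum of size at most \<open>\<rho>\<close>, too small to cancel the \<open>1\<close>.\<close>

lemma eval_fps_near_1: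
  fixes f :: "'a :: {banach, real_normed_field} fps"
  assumes bound: "\<And>K. (\<Sum>n\<le>K. norm (fps_nth (f - 1) n) * r ^ n) \<le> \<rho>"
    and "\<rho> < 1" and q: "norm q \<le> r"
  shows "summable (\<lambda>n. fps_nth f n * q ^ n)" and "eval_fps f q \<noteq> 0"
proof -
  define a where "a = (\<lambda>n. fps_nth (f - 1) n * q ^ n)"
  have sum_le: "(\<Sum>n\<le>K. norm (a n)) \<le> \<rho>" for K
  proof -
    have "(\<Sum>n\<le>K. norm (a n)) \<le> (\<Sum>n\<le>K. norm (fps_nth (f - 1) n) * r ^ n)"
      using q by (auto simp: a_def norm_mult norm_power intro!: sum_mono mult_left_mono power_mono)
    thus ?thesis using bound[of K] by linarith
  qed
  have summ: "summable (\<lambda>n. norm (a n))"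
    by (rule bounded_imp_summable[of _ \<rho>]) (use sum_le in auto)
  have "(\<lambda>K. \<Sum>n\<le>K. norm (a n)) \<longlonglongrightarrow> (\<Sum>n. norm (a n))"
    by (rule summable_LIMSEQ'[OF summ])
  hence "(\<Sum>n. norm (a n)) \<le> \<rho>"
    by (rule LIMSEQ_le_const2) (use sum_le in auto)
  hence small: "norm (\<Sum>n. a n) < 1"
    using summable_norm[OF summ] \<open>\<rho> < 1\<close> by linarith
  have "(\<lambda>n. a n + (if n = 0 then 1 else 0)) sums ((\<Sum>n. a n) + 1)"
    using summable_sums[OF summable_norm_cancel[OF summ]] sums_single[of 0 "\<lambda>_. 1 :: 'a"]
    by (rule sums_add)
  moreover have "(\<lambda>n. a n + (if n = 0 then 1 else 0)) = (\<lambda>n. fps_nth f n * q ^ n)"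
    by (auto simp: a_def algebra_simps)
  ultimately have sums: "(\<lambda>n. fps_nth f n * q ^ n) sums ((\<Sum>n. a n) + 1)"
    by simp
  show "summable (\<lambda>n. fps_nth f n * q ^ n)"
    using sums by (rule sums_summable)
  have "eval_fps f q = (\<Sum>n. a n) + 1"
    using sums unfolding eval_fps_def by (rule sums_unique [symmetric])
  moreover have "(\<Sum>n. a n) \<noteq> - 1"
    using small by auto
  ultimately show "eval_fps f q \<noteq> 0"
    by (simp add: add_eq_0_iff2)
qed

lemma of_int_fps_diff_1: "of_int_fps f - 1 = of_int_fps (f - 1)"
  by (simp add: fps_eq_iff of_int_fps_def)

lemma q_real_eval:
  fixes q :: complex
  assumes "x \<ge> 1" and q: "norm q < 2 - sqrt 3"
  shows "summable (\<lambda>n. fps_nth (of_int_fps (q_real x)) n * q ^ n)"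
    and "eval_fps (of_int_fps (q_real x)) q \<noteq> 0"
proof -
  \<comment> \<open>The weight is chosen rational because the coefficients of the convergents are.\<close>
  obtain s :: rat where s: "norm q < of_rat s" "real_of_rat s < 2 - sqrt 3"
    using of_rat_dense[OF q] by blast
  define r where "r = real_of_rat s"
  have r: "0 \<le> r" "r < 1" "2 * r < 1"
  proof -
    show "0 \<le> r" using s(1) norm_ge_zero[of q] unfolding r_def by linarith
    have "3 / 2 < sqrt 3" by (rule real_less_rsqrt) (simp add: power2_eq_square)
    thus "r < 1" "2 * r < 1" using s(2) unfolding r_def by linarith+
  qed
  \<comment> \<open>As \<open>2 - sqrt 3\<close> is the smaller root of \<open>t\<^sup>2 - 4 t + 1\<close>, even \<open>4 r < 1 + r\<^sup>2\<close> holds.\<close>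
  have "sqrt 3 ^ 2 < (2 - r) ^ 2"
    using s(2) by (intro power_strict_mono) (auto simp: r_def)
  hence "3 * r \<le> 1 + r ^ 2" using r(1) by (simp add: power2_eq_square algebra_simps)
  hence "real_of_rat (3 * s) \<le> real_of_rat (1 + s ^ 2)"
    by (simp add: r_def of_rat_mult of_rat_add of_rat_power)
  hence "3 * s \<le> 1 + s ^ 2" by (simp only: of_rat_less_eq)
  moreover have "0 \<le> s" "s < 1" using r by (auto simp: r_def)
  ultimately have ball: "trunc_norm s K (of_int_fps (q_real x) - 1) \<le> s / (1 - s)" for K
    using q_real_in_ball[OF \<open>x \<ge> 1\<close>] by blast
  have abs: "real_of_rat \<bar>of_int k\<bar> = norm (of_int k :: complex)" for k
    by (simp flip: of_int_abs)
  have bound: "(\<Sum>n\<le>K. norm (fps_nth (of_int_fps (q_real x) - 1 :: complex fps) n) * r ^ n) \<le> r / (1 - r)"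
    for K
  proof -
    have "(\<Sum>n\<le>K. norm (fps_nth (of_int_fps (q_real x) - 1 :: complex fps) n) * r ^ n) =
        real_of_rat (trunc_norm s K (of_int_fps (q_real x) - 1))"
      unfolding of_int_fps_diff_1
      by (simp add: trunc_norm_def of_int_fps_def r_def of_rat_sum of_rat_mult of_rat_power abs
          del: fps_sub_nth)
    also have "\<dots> \<le> real_of_rat (s / (1 - s))"
      using ball by (simp only: of_rat_less_eq)
    finally show ?thesis by (simp add: r_def of_rat_divide of_rat_diff)
  qed
  have small: "r / (1 - r) < 1" using r by simp
  have "norm q \<le> r" using s(1) by (simp add: r_def)
  show "summable (\<lambda>n. fps_nth (of_int_fps (q_real x)) n * q ^ n)"
    and "eval_fps (of_int_fps (q_real x)) q \<noteq> 0"
    by (rule eval_fps_near_1[OF bound small \<open>norm q \<le> r\<close>])+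
qed

theorem theorem1p2:
  fixes x :: real
  assumes "x \<ge> 1"
  shows "(\<forall>q :: complex. norm q < 2 - sqrt 3 \<longrightarrow>
           summable (\<lambda>n. of_int (fps_nth (q_real x) n) * q ^ n))
    \<and> eval_fps (of_int_fps (q_real x)) holomorphic_on ball (0 :: complex) (2 - sqrt 3)
    \<and> (\<forall>q \<in> ball (0 :: complex) (2 - sqrt 3). eval_fps (of_int_fps (q_real x)) q \<noteq> 0)"
proof (intro conjI allI ballI impI)
  show "summable (\<lambda>n. of_int (fps_nth (q_real x) n) * q ^ n)" if "norm q < 2 - sqrt 3" for q :: complex
    using q_real_eval(1)[OF assms that] by (simp add: of_int_fps_def)
  have "ereal (2 - sqrt 3) \<le> fps_conv_radius (of_int_fps (q_real x) :: complex fps)"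
    unfolding fps_conv_radius_def
    by (intro conv_radius_geI_ex' q_real_eval(1)[OF assms]) simp
  thus "eval_fps (of_int_fps (q_real x)) holomorphic_on ball (0 :: complex) (2 - sqrt 3)"
    by (intro holomorphic_on_eval_fps ball_eball_mono)
  show "eval_fps (of_int_fps (q_real x)) q \<noteq> 0" if "q \<in> ball 0 (2 - sqrt 3)" for q :: complex
    using q_real_eval(2)[OF assms] that by simp
qed

end
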